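(* Let $t\ge 1$ be an integer and let $n=T_t=\frac{t(t+1)}{2}$. Then the maximal degree of the partition graph $G_n$ is \[ \Delta_n=t(t-1), \] and the unique vertex of $G_n$ of degree $\Delta_n$ is the staircase partition $\delta_t=(t,t-1,\dots,1)$.
   Context: A partition $\lambda\vdash n$ is a finite nonincreasing sequence of positive integers with sum $n$. The partition graph $G_n$ ($n\ge 1$) is the simple graph whose vertices are the partitions of $n$; two distinct partitions are adjacent if one is obtained from the other by an elementary transfer of one unit between two parts, followed by reordering: one part is decreased by $1$ and another part is increased by $1$. Here the receiving part may be an empty part of size $0$ (so that a new part $1$ is created), and a part that becomes $0$ is discarded. $\deg(\lambda)$ denotes the degree of the vertex $\lambda$ in $G_n$, and $\Delta_n:=\max_{\lambda\vdash n}\deg(\lambda)$. *)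

theory Defs
  imports Main
begin

definition partitions :: "nat \<Rightarrow> nat list set" where
  "partitions n = {p. sorted_wrt (\<ge>) p \<and> (\<forall>a\<in>set p. 0 < a) \<and> sum_list p = n}"

text \<open>
  The partition \<open>p\<close> is extended by one empty part, at index \<open>length p\<close>, which may receive
  a unit but cannot give one. Part \<open>i\<close> gives one unit to part \<open>j\<close>; empty parts are then
  discarded and the result is reordered.
\<close>

definition transfer :: "nat list \<Rightarrow> nat \<Rightarrow> nat \<Rightarrow> nat list" where
  "transfer p i j =
     (let q = p @ [0]
      in rev (sort (filter (\<lambda>a. 0 < a) (q[i := q ! i - 1, j := q ! j + 1]))))"

definition elementary_transfer :: "nat list \<Rightarrow> nat list \<Rightarrow> bool" where
  "elementary_transfer p q \<longleftrightarrow>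
     (\<exists>i j. i < length p \<and> j \<le> length p \<and> i \<noteq> j \<and> q = transfer p i j)"

text \<open>
  The partition graph on \<open>n\<close> has vertex set \<open>partitions n\<close> and the following adjacency
  relation, which is irreflexive and symmetric by construction.
\<close>

definition adjacent :: "nat \<Rightarrow> nat list \<Rightarrow> nat list \<Rightarrow> bool" where
  "adjacent n p q \<longleftrightarrow> p \<in> partitions n \<and> q \<in> partitions n \<and> p \<noteq> q \<and>
     (elementary_transfer p q \<or> elementary_transfer q p)"

definition degree :: "nat \<Rightarrow> nat list \<Rightarrow> nat" where
  "degree n p = card {q. adjacent n p q}"

definition max_degree :: "nat \<Rightarrow> nat" where
  "max_degree n = Max (degree n ` partitions n)"

definition staircase :: "nat \<Rightarrow> nat list" where
  "staircase t = rev [1..<Suc t]"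

text \<open>The cardinality and the maximum above are taken over finite, resp. nonempty finite, sets.\<close>

lemma length_le_sum_list:
  fixes p :: "nat list"
  assumes "\<forall>a\<in>set p. 0 < a"
  shows "length p \<le> sum_list p"
  using assms by (induction p) auto

lemma finite_partitions: "finite (partitions n)"
proof (rule finite_subset)
  show "partitions n \<subseteq> {p. set p \<subseteq> {..n} \<and> length p \<le> n}"
    using length_le_sum_list member_le_sum_list by (fastforce simp: partitions_def)
  show "finite {p. set p \<subseteq> {..n} \<and> length p \<le> n}"
    by (rule finite_lists_length_le) simp
qed

lemma partitions_nonempty: "partitions n \<noteq> {}"
proof -
  have "(if n = 0 then [] else [n]) \<in> partitions n"
    by (simp add: partitions_def)
  then show ?thesis by blast
qed

lemma finite_neighbours: "finite {q. adjacent n p q}"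
  by (rule finite_subset[OF _ finite_partitions[of n]]) (auto simp: adjacent_def)

end

theory Submission
  imports Defs "HOL-Library.Multiset"
begin

text \<open>
  Let \<open>p\<close> have \<open>k\<close> distinct part sizes, forming the set \<open>S\<close>. The result of a transfer depends
  only on the size \<open>a\<close> of the donor and the size \<open>b\<close> of the recipient, where \<open>a \<in> S\<close> and
  \<open>b \<in> S \<union> {0}\<close>. In terms of the conjugate partition, row \<open>a - 1\<close> loses a cell and row \<open>b\<close> gains
  one; moving the cell back is again a transfer, so both directions of the adjacency give the
  same neighbours. Hence the transfer is trivial iff \<open>b = a - 1\<close>, and distinct nontrivial pairs give distinct
  neighbours; the only other constraint is that \<open>a = b\<close> requires a repeated part. So the degree
  is the number of such pairs (\<open>degree_eq_card_move_pairs\<close>). In particular it is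
  at most \<open>k (k + 1)\<close>, and it is strictly smaller if \<open>1 \<in> S\<close> (the pair \<open>(1, 0)\<close> is lost) or if
  some part is not repeated.

  Now let \<open>n = 1 + \<dots> + t\<close>. Since \<open>n\<close> is at least the sum of \<open>S\<close>, we have \<open>k \<le> t\<close>, and \<open>k = t\<close> forces
  \<open>p\<close> to be the staircase, whose degree is \<open>t (t - 1)\<close>. If \<open>k < t\<close>, the degree is at most
  \<open>k (k + 1) \<le> t (t - 1)\<close>. Equality would require \<open>k = t - 1\<close>, \<open>1 \<notin> S\<close> and every part repeated,
  so that \<open>n \<ge> 2 (2 + \<dots> + t) = 2 n - 2\<close>, which fails for \<open>t \<ge> 2\<close>; for \<open>t = 1\<close>, the
  condition \<open>k = 0\<close> contradicts \<open>n = 1\<close>.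
\<close>

section \<open>Conjugate partitions and transfers\<close>

text \<open>
  Row \<open>m\<close> of the conjugate partition, with rows numbered from \<open>0\<close>: the number of parts
  exceeding \<open>m\<close>.
\<close>

definition conj_row :: "nat list \<Rightarrow> nat \<Rightarrow> nat" where
  "conj_row p m = length (filter (\<lambda>a. m < a) p)"

lemma conj_row_eq_sum_list: "conj_row p m = (\<Sum>a\<leftarrow>p. of_bool (m < a))"
  unfolding conj_row_def by (induction p) auto

lemma conj_row_Suc_count: "conj_row p m = conj_row p (Suc m) + count_list p (Suc m)"
  unfolding conj_row_def by (induction p) auto

lemma partition_eq_if_conj_row_eq:
  assumes p: "p \<in> partitions n" and q: "q \<in> partitions n'"
    and eq: "\<And>m. conj_row p m = conj_row q m"
  shows "p = q"
proof -
  have "count_list p v = count_list q v" for v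
  proof (cases v)
    case 0
    have "0 \<notin> set p" "0 \<notin> set q" using p q by (auto simp: partitions_def)
    then show ?thesis using 0 by simp
  next
    case (Suc m)
    then show ?thesis
      using conj_row_Suc_count[of p m] conj_row_Suc_count[of q m] eq by simp
  qed
  then have "mset (rev p) = mset (rev q)"
    by (simp add: multiset_eq_iff count_mset)
  moreover have "sorted (rev p)" "sorted (rev q)"
    using p q by (simp_all add: partitions_def sorted_wrt_rev)
  ultimately have "rev p = rev q"
    by (metis properties_for_sort)
  then show ?thesis by simp
qed

lemma sum_list_map_list_update:
  fixes f :: "'a \<Rightarrow> nat"
  assumes "i < length xs"
  shows "sum_list (map f (xs[i := v])) + f (xs ! i) = sum_list (map f xs) + f v"
  using assms
proof (induction xs arbitrary: i)
  case (Cons x xs)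
  then show ?case by (cases i) force+
qed simp

text \<open>
  The choices \<open>f a = a\<close> and \<open>f a = of_bool (m < a)\<close> give the effect of a transfer on the sum and
  on the rows of the conjugate partition.
\<close>

lemma sum_list_map_transfer:
  fixes f :: "nat \<Rightarrow> nat"
  assumes "i < length p" "j \<le> length p" "i \<noteq> j" and f0: "f 0 = 0"
  shows "sum_list (map f (transfer p i j)) + f (p ! i) + f ((p @ [0]) ! j) =
    sum_list (map f p) + f (p ! i - 1) + f ((p @ [0]) ! j + 1)"
proof -
  define q where "q = p @ [0]"
  define r where "r = q[i := q ! i - 1, j := q ! j + 1]"
  have qi: "q ! i = p ! i" using assms by (simp add: q_def nth_append)
  have "sum_list (map f (transfer p i j)) = sum_list (map f (filter (\<lambda>a. 0 < a) r))"
    by (simp add: transfer_def Let_def q_def r_def flip: sum_mset_sum_list)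
  also have "\<dots> = sum_list (map f r)"
    by (rule sum_list_map_filter) (use f0 in auto)
  finally have 1: "sum_list (map f (transfer p i j)) = sum_list (map f r)" .
  have 2: "sum_list (map f r) + f (q ! j) =
      sum_list (map f (q[i := q ! i - 1])) + f (q ! j + 1)"
    using sum_list_map_list_update[of j "q[i := q ! i - 1]" f "q ! j + 1"] assms
    by (simp add: r_def q_def)
  have 3: "sum_list (map f (q[i := q ! i - 1])) + f (q ! i) = sum_list (map f p) + f (q ! i - 1)"
    using sum_list_map_list_update[of i q f "q ! i - 1"] assms f0 by (simp add: q_def)
  show ?thesis
    using 1 2 3 qi unfolding q_def by simp
qed

lemma transfer_in_partitions:
  assumes "p \<in> partitions n" "i < length p" "j \<le> length p" "i \<noteq> j"
  shows "transfer p i j \<in> partitions n"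
proof -
  have "0 < p ! i" using assms by (auto simp: partitions_def)
  then have "sum_list (transfer p i j) = sum_list p"
    using sum_list_map_transfer[OF assms(2-4), of "\<lambda>a. a"] by simp
  moreover have "sorted_wrt (\<ge>) (transfer p i j)"
    by (simp add: transfer_def Let_def sorted_wrt_rev)
  ultimately show ?thesis
    using assms(1) by (auto simp: partitions_def transfer_def Let_def)
qed

lemma conj_row_transfer:
  assumes "i < length p" "j \<le> length p" "i \<noteq> j" "0 < p ! i"
  shows "conj_row (transfer p i j) m + of_bool (m = p ! i - 1) =
    conj_row p m + of_bool (m = (p @ [0]) ! j)"
proof -
  have "of_bool (m < p ! i) = of_bool (m < p ! i - 1) + (of_bool (m = p ! i - 1) :: nat)"
    using assms(4) by auto
  moreover have "of_bool (m < b + 1) = of_bool (m < b) + (of_bool (m = b) :: nat)" for b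
    by auto
  ultimately show ?thesis
    using sum_list_map_transfer[OF assms(1-3), of "\<lambda>a. of_bool (m < a)"]
    by (simp add: conj_row_eq_sum_list del: of_bool_eq_iff)
qed

section \<open>The degree formula\<close>

text \<open>
  The pairs \<open>(a, b)\<close> of sizes of a donor and a recipient for which the transfer is possible and
  not trivial. The size \<open>b = 0\<close> stands for the empty part.
\<close>

definition move_pairs :: "nat list \<Rightarrow> (nat \<times> nat) set" where
  "move_pairs p = {(a, b). a \<in> set p \<and> b \<in> insert 0 (set p) \<and> b \<noteq> a - 1 \<and>
     (a = b \<longrightarrow> 2 \<le> count_list p a)}"

text \<open>
  The condition that the rows of the conjugate of \<open>q\<close> are those of the conjugate of \<open>p\<close> with one
  cell moved from row \<open>a - 1\<close> to row \<open>b\<close>. It is stated without subtraction on the row lengths.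
\<close>

definition moves_cell :: "nat list \<Rightarrow> nat list \<Rightarrow> nat \<times> nat \<Rightarrow> bool" where
  "moves_cell p q = (\<lambda>(a, b). \<forall>m.
     conj_row q m + of_bool (m = a - 1) = conj_row p m + of_bool (m = b))"

text \<open>
  For \<open>b \<noteq> a - 1\<close>, the row that gains a cell and the row that loses one can be read off from
  the two conjugates. Donors are positive, so \<open>a - 1\<close> determines \<open>a\<close>.
\<close>

lemma moves_cell_pair_unique:
  assumes "moves_cell p q x" "moves_cell p q y" "x \<in> move_pairs p" "y \<in> move_pairs p"
    and pos: "\<forall>a\<in>set p. 0 < a"
  shows "x = y"
proof -
  obtain a b c d where xy: "x = (a, b)" "y = (c, d)" by (cases x, cases y)
  have 1: "conj_row q m + of_bool (m = a - 1) = conj_row p m + of_bool (m = b)"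
    and 2: "conj_row q m + of_bool (m = c - 1) = conj_row p m + of_bool (m = d)" for m
    using assms(1,2) by (simp_all add: xy moves_cell_def)
  have "b \<noteq> a - 1" "d \<noteq> c - 1" "0 < a" "0 < c"
    using assms(3,4) pos by (auto simp: xy move_pairs_def)
  moreover from this have "b = d"
    using 1[of b] 2[of b] by (auto split: if_splits simp: of_bool_def)
  moreover have "a - 1 = c - 1"
    using 1[of "a - 1"] 2[of "a - 1"] \<open>b \<noteq> a - 1\<close> by (auto split: if_splits simp: of_bool_def)
  ultimately show ?thesis by (simp add: xy)
qed

text \<open>
  A move of a cell between two rows leads to a partition only if the pair of sizes is admissible,
  because the rows of the conjugate of \<open>q\<close> must be nonincreasing.
\<close>

lemma move_pair_if_moves_cell:
  assumes cell: "moves_cell p q (Suc y, x)" and "x \<noteq> y"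
  shows "(Suc y, x) \<in> move_pairs p"
proof -
  have R: "conj_row q m + of_bool (m = y) = conj_row p m + of_bool (m = x)" for m
    using cell by (simp add: moves_cell_def)
  have anti: "conj_row q (Suc m) \<le> conj_row q m" for m
    using conj_row_Suc_count[of q m] by simp
  have count: "count_list p (Suc y) \<ge> 1 + of_bool (x = Suc y)"
    using R[of y] R[of "Suc y"] anti[of y] conj_row_Suc_count[of p y] \<open>x \<noteq> y\<close> by auto
  then have "Suc y \<in> set p"
    by (metis count_list_0_iff add_is_0 le_zero_eq zero_neq_one)
  moreover have "x \<in> insert 0 (set p)"
  proof (cases x)
    case (Suc z)
    then have "count_list p x \<ge> 1"
      using R[of x] R[of z] anti[of z] conj_row_Suc_count[of p z] \<open>x \<noteq> y\<close>
      by (auto simp: of_bool_def split: if_splits)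
    then show ?thesis
      by (metis count_list_0_iff not_one_le_zero insertI2)
  qed simp
  ultimately show ?thesis
    using \<open>x \<noteq> y\<close> count by (auto simp: move_pairs_def)
qed

lemma elementary_transfer_moves_cell:
  assumes "p \<in> partitions n" "elementary_transfer p q"
  obtains x y where "moves_cell p q (Suc y, x)"
proof -
  obtain i j where ij: "i < length p" "j \<le> length p" "i \<noteq> j" "q = transfer p i j"
    using assms(2) by (auto simp: elementary_transfer_def)
  have "0 < p ! i" using assms(1) ij by (auto simp: partitions_def)
  then have "moves_cell p q (Suc (p ! i - 1), (p @ [0]) ! j)"
    using conj_row_transfer[OF ij(1-3)] ij(4) by (simp add: moves_cell_def)
  then show ?thesis using that by blast
qed

lemma moves_cell_sym:
  assumes "moves_cell p q (Suc y, x)"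
  shows "moves_cell q p (Suc x, y)"
  using assms by (simp add: moves_cell_def)

lemma adjacent_imp_move_pair:
  assumes "adjacent n p q"
  shows "\<exists>x\<in>move_pairs p. moves_cell p q x"
proof -
  have part: "p \<in> partitions n" "q \<in> partitions n" and "p \<noteq> q"
    using assms by (auto simp: adjacent_def)
  obtain x y where xy: "moves_cell p q (Suc y, x)"
    using assms part elementary_transfer_moves_cell moves_cell_sym
    unfolding adjacent_def by metis
  have "x \<noteq> y"
    using xy partition_eq_if_conj_row_eq[OF part] \<open>p \<noteq> q\<close> by (auto simp: moves_cell_def)
  then show ?thesis using move_pair_if_moves_cell[OF xy] xy by blast
qed

lemma move_pair_imp_adjacent:
  assumes p: "p \<in> partitions n" and x: "x \<in> move_pairs p"
  shows "\<exists>q. adjacent n p q \<and> moves_cell p q x"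
proof -
  obtain a b where ab: "x = (a, b)" "a \<in> set p" "b \<in> insert 0 (set p)" "b \<noteq> a - 1"
      "a = b \<Longrightarrow> 2 \<le> count_list p a"
    using x by (auto simp: move_pairs_def)
  have pos: "\<forall>a\<in>set p. 0 < a" using p by (simp add: partitions_def)
  obtain i j where ij: "i < length p" "j \<le> length p" "i \<noteq> j" "p ! i = a" "(p @ [0]) ! j = b"
  proof (cases "a = b")
    case True
    then have "count_list p a = Suc (Suc (count_list p a - 2))"
      using ab(5) by simp
    then obtain xs r where r: "p = xs @ a # r" "count_list r a = Suc (count_list p a - 2)"
      by (blast dest: count_list_Suc_split_first)
    from count_list_Suc_split_first[OF r(2)] obtain ys zs where "r = ys @ a # zs"
      by blast
    with r(1) have "p = xs @ a # ys @ a # zs" by simp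
    with True show ?thesis
      by (intro that[of "length xs" "Suc (length xs + length ys)"]) (auto simp: nth_append)
  next
    case False
    obtain i where i: "i < length p" "p ! i = a" using ab(2) by (auto simp: in_set_conv_nth)
    have "b \<in> set (p @ [0])" using ab(3) by auto
    then obtain j where j: "j < length (p @ [0])" "(p @ [0]) ! j = b"
      by (metis in_set_conv_nth)
    have "i \<noteq> j" using i j False by (auto simp: nth_append)
    then show ?thesis using that[of i j] i j by simp
  qed
  define q where "q = transfer p i j"
  have cell: "moves_cell p q x"
    using conj_row_transfer[OF ij(1-3)] ij ab pos by (simp add: moves_cell_def q_def)
  have "q \<noteq> p"
  proof
    assume "q = p"
    then have "conj_row p b + of_bool (b = a - 1) = conj_row p b + 1"
      using cell by (simp add: moves_cell_def ab(1))
    then show False using ab(4) by simp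
  qed
  then have "adjacent n p q"
    using p transfer_in_partitions[OF p ij(1-3)] ij
    by (auto simp: adjacent_def elementary_transfer_def q_def)
  then show ?thesis using cell by blast
qed

lemma degree_eq_card_move_pairs:
  assumes p: "p \<in> partitions n"
  shows "degree n p = card (move_pairs p)"
proof -
  obtain f where f: "\<And>x. x \<in> move_pairs p \<Longrightarrow> adjacent n p (f x) \<and> moves_cell p (f x) x"
    using move_pair_imp_adjacent[OF p] by metis
  have "bij_betw f (move_pairs p) {q. adjacent n p q}"
    unfolding bij_betw_def
  proof
    show "inj_on f (move_pairs p)"
      using moves_cell_pair_unique[of p] f p by (metis (no_types, lifting) inj_onI
          mem_Collect_eq partitions_def)
    have "q \<in> f ` move_pairs p" if adj: "adjacent n p q" for q
    proof -
      obtain x where x: "x \<in> move_pairs p" "moves_cell p q x"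
        using adjacent_imp_move_pair[OF adj] by blast
      have "f x \<in> partitions n" "q \<in> partitions n"
        using f[OF x(1)] adj by (auto simp: adjacent_def)
      moreover have "conj_row (f x) m = conj_row q m" for m
      proof -
        obtain a b where "x = (a, b)" by (cases x)
        then have "conj_row (f x) m + of_bool (m = a - 1) = conj_row q m + of_bool (m = a - 1)"
          using f[OF x(1)] x(2) by (simp add: moves_cell_def)
        then show ?thesis by simp
      qed
      ultimately have "f x = q" by (rule partition_eq_if_conj_row_eq)
      then show ?thesis using x by blast
    qed
    then show "f ` move_pairs p = {q. adjacent n p q}"
      using f by blast
  qed
  then show ?thesis
    by (simp add: degree_def bij_betw_same_card)
qed

section \<open>Partitions of a triangular number\<close>

lemma sum_ge_sum_initial_segment:
  fixes S :: "nat set"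
  assumes "finite S" "\<forall>a\<in>S. c \<le> a"
  shows "(\<Sum>i<card S. c + i) \<le> \<Sum>S"
  using assms
proof (induction S rule: finite_linorder_max_induct)
  case (insert b A)
  have "A \<subseteq> {c..<b}" using insert by auto
  then have "card A \<le> b - c"
    by (metis card_atLeastLessThan card_mono finite_atLeastLessThan)
  then have "c + card A \<le> b" using insert.prems by auto
  then show ?case using insert by (auto simp: not_less_iff_gr_or_eq)
qed simp

lemma sum_initial_segment: "2 * (\<Sum>i<k. c + i) + k = 2 * c * k + k * (k :: nat)"
  by (induction k) (auto simp: algebra_simps)

lemma sum_list_eq_sum_count: "sum_list p = (\<Sum>a\<in>set p. count_list p a * (a :: nat))"
  using sum_list_map_eq_sum_count[of "\<lambda>a. a" p] by simp

lemma staircase_in_partitions: "staircase t \<in> partitions (t * (t + 1) div 2)"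
proof -
  have "2 * sum_list [1..<Suc t] = t * (t + 1)"
    by (induction t) auto
  then show ?thesis
    by (simp add: partitions_def staircase_def sorted_wrt_rev del: upt_Suc)
qed

lemma degree_staircase: "degree (t * (t + 1) div 2) (staircase t) = t * (t - 1)"
proof -
  have set: "set (staircase t) = {1..t}" by (auto simp: staircase_def)
  have "distinct (staircase t)" by (simp add: staircase_def del: upt_Suc)
  then have "\<not> 2 \<le> count_list (staircase t) a" for a
    by (auto simp: distinct_count_atmost_1 count_mset)
  then have "move_pairs (staircase t) = (SIGMA a:{1..t}. {0..t} - {a - 1, a})"
    unfolding move_pairs_def set by auto
  moreover have "card ({0..t} - {a - 1, a}) = t - 1" if "a \<in> {1..t}" for a
    using that by (subst card_Diff_subset) auto
  ultimately have "card (move_pairs (staircase t)) = t * (t - 1)"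
    by simp
  then show ?thesis
    using degree_eq_card_move_pairs[OF staircase_in_partitions] by simp
qed

lemma sum_set_le_sum_list: "\<Sum>(set p) \<le> sum_list (p :: nat list)"
  unfolding sum_list_eq_sum_count
  by (rule sum_mono) (metis count_list_0_iff le_square mult_le_mono1 nat_mult_1 less_one not_le)

lemma card_set_le_if_triangular:
  assumes p: "p \<in> partitions (t * (t + 1) div 2)"
  shows "card (set p) \<le> t"
proof (rule ccontr)
  assume "\<not> card (set p) \<le> t"
  then have k: "Suc t \<le> card (set p)" by simp
  have "(\<Sum>i<Suc t. 1 + i) \<le> (\<Sum>i<card (set p). 1 + i)"
    by (rule sum_mono2) (use k in auto)
  also have "\<dots> \<le> \<Sum>(set p)"
    by (rule sum_ge_sum_initial_segment) (use p in \<open>auto simp: partitions_def Suc_le_eq\<close>)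
  also have "\<dots> \<le> t * (t + 1) div 2"
    using sum_set_le_sum_list[of p] p by (simp add: partitions_def)
  finally show False
    using sum_initial_segment[of 1 "Suc t"] by (simp add: algebra_simps)
qed

lemma eq_staircase_if_card_set_eq:
  assumes p: "p \<in> partitions (t * (t + 1) div 2)" and k: "card (set p) = t"
  shows "p = staircase t"
proof -
  have sum: "2 * sum_list p = t * (t + 1)" and pos: "\<forall>a\<in>set p. 0 < a"
    using p by (auto simp: partitions_def)
  have seg: "2 * (\<Sum>i<t. 1 + i) = t * (t + 1)"
    using sum_initial_segment[of 1 t] by (simp add: algebra_simps)
  have "(\<Sum>i<t. 1 + i) \<le> \<Sum>(set p)"
    using sum_ge_sum_initial_segment[of "set p" 1] k pos by (auto simp: Suc_le_eq)
  then have sum_eq: "\<Sum>(set p) = sum_list p"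
    using sum_set_le_sum_list[of p] sum seg by linarith
  \<comment> \<open>The other parts already sum to at least \<open>1 + \<dots> + (t - 1)\<close>, which leaves at most \<open>t\<close>.\<close>
  have set: "set p \<subseteq> {1..t}"
  proof
    fix b assume b: "b \<in> set p"
    have "(\<Sum>i<t - 1. 1 + i) \<le> \<Sum>(set p - {b})"
      using sum_ge_sum_initial_segment[of "set p - {b}" 1] k pos b by (auto simp: Suc_le_eq)
    moreover have "\<Sum>(set p) = b + \<Sum>(set p - {b})"
      using b by (simp add: sum.remove)
    moreover have "(\<Sum>i<t. 1 + i) = (\<Sum>i<t - 1. 1 + i) + t"
      by (cases t) auto
    ultimately show "b \<in> {1..t}"
      using sum_eq sum seg pos b by (auto simp: Suc_le_eq)
  qed
  then have set_eq: "set p = {1..t}"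
    by (intro card_subset_eq) (use k in auto)
  have "count_list p b = 1" if b: "b \<in> set p" for b
  proof (rule ccontr)
    have ge: "1 \<le> count_list p a" if "a \<in> set p" for a
      using that by (metis count_list_0_iff less_one not_le)
    assume "count_list p b \<noteq> 1"
    then have "1 < count_list p b" using ge[OF b] by simp
    then have "\<Sum>(set p) < (\<Sum>a\<in>set p. count_list p a * a)"
      using ge pos b by (intro sum_strict_mono_ex1) auto
    then show False using sum_eq sum_list_eq_sum_count[of p] by simp
  qed
  then have "distinct p"
    by (auto simp: distinct_count_atmost_1 count_mset count_list_0_iff)
  then have "distinct (rev p)" by simp
  moreover have "sorted (rev p)" using p by (simp add: partitions_def sorted_wrt_rev)
  moreover have "set (rev p) = set [1..<Suc t]"
    by (simp add: set_eq atLeastLessThanSuc_atLeastAtMost del: upt_Suc)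
  ultimately have "rev p = [1..<Suc t]"
    by (simp add: sorted_distinct_set_unique del: upt_Suc)
  then show ?thesis by (metis rev_rev_ident staircase_def)
qed

lemma degree_less_if_card_set_less:
  assumes p: "p \<in> partitions n" and n: "n = t * (t + 1) div 2" and k: "card (set p) < t"
  shows "degree n p < t * (t - 1)"
proof -
  define S where "S = set p"
  have pos: "\<forall>a\<in>S. 0 < a" and sum: "sum_list p = n"
    using p by (auto simp: partitions_def S_def)
  have sub: "move_pairs p \<subseteq> S \<times> insert 0 S"
    by (auto simp: move_pairs_def S_def)
  have fin: "finite (S \<times> insert 0 S)" by (simp add: S_def)
  have card: "card (S \<times> insert 0 S) = card S * (card S + 1)"
    using pos by (subst card_cartesian_product) (auto simp: S_def card_insert_if)
  have le: "card S * (card S + 1) \<le> t * (t - 1)"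
    using k mult_le_mono[of "card S" "t - 1" "card S + 1" t] by (simp add: S_def mult.commute)
  have deg: "degree n p = card (move_pairs p)"
    using p by (rule degree_eq_card_move_pairs)
  show ?thesis
  proof (cases "1 \<in> S \<or> (\<exists>a\<in>S. count_list p a < 2)")
    case True
    then have "(1, 0) \<in> S \<times> insert 0 S - move_pairs p \<or>
        (\<exists>a. (a, a) \<in> S \<times> insert 0 S - move_pairs p)"
      by (auto simp: move_pairs_def)
    then have "move_pairs p \<subset> S \<times> insert 0 S" using sub by blast
    from psubset_card_mono[OF fin this] show ?thesis
      using card le deg by linarith
  next
    case False
    have "card S \<noteq> t - 1"
    proof
      assume kt: "card S = t - 1"
      have "\<forall>a\<in>S. 2 \<le> a"
        using False pos by (metis One_nat_def Suc_1 Suc_leI le_neq_implies_less)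
      then have "(\<Sum>i<card S. 2 + i) \<le> \<Sum>S"
        by (intro sum_ge_sum_initial_segment) (auto simp: S_def)
      moreover have "2 * \<Sum>S \<le> n"
        unfolding sum[symmetric] sum_list_eq_sum_count sum_distrib_left S_def[symmetric]
        by (rule sum_mono) (use False in auto)
      ultimately have "2 * (\<Sum>i<card S. 2 + i) \<le> n" by (meson le_trans mult_le_mono2)
      then have "4 * card S + card S * card S \<le> n + card S"
        using sum_initial_segment[of 2 "card S"] by linarith
      moreover have "2 * n = t * (t + 1)" using n by simp
      moreover obtain s where t: "t = Suc s" using k by (cases t) auto
      ultimately have "3 * s + s * s \<le> 2" using kt by (simp add: algebra_simps)
      then have "s = 0" by (cases s) auto
      \<comment> \<open>Then \<open>n = 1\<close>, although \<open>p\<close> has no parts.\<close>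
      then show False using kt t n sum by (auto simp: S_def)
    qed
    then have "card S + 1 < t" using k by (simp add: S_def)
    then have "card S * (card S + 1) < t * (t - 1)"
      using mult_less_le_imp_less[of "card S" "t - 1" "card S + 1" t] by (simp add: mult.commute)
    then show ?thesis
      using card_mono[OF fin sub] card deg by simp
  qed
qed

theorem theorem3p10:
  fixes t n :: nat
  assumes "t \<ge> 1"
    and "n = t * (t + 1) div 2"
  shows "max_degree n = t * (t - 1) \<and>
    {p \<in> partitions n. degree n p = max_degree n} = {staircase t}"
proof -
  have stair: "staircase t \<in> partitions n" "degree n (staircase t) = t * (t - 1)"
    using staircase_in_partitions degree_staircase assms(2) by simp_all
  have less: "degree n p < t * (t - 1)" if "p \<in> partitions n" "p \<noteq> staircase t" for p
  proof -
    have "card (set p) < t"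
      using that assms(2) card_set_le_if_triangular eq_staircase_if_card_set_eq
      by (metis le_neq_implies_less)
    then show ?thesis using that(1) assms(2) degree_less_if_card_set_less by blast
  qed
  have "max_degree n = t * (t - 1)"
    unfolding max_degree_def
  proof (rule Max_eqI)
    show "finite (degree n ` partitions n)" by (simp add: finite_partitions)
    show "d \<le> t * (t - 1)" if "d \<in> degree n ` partitions n" for d
      using that less stair(2) by (metis imageE less_imp_le order_refl)
    show "t * (t - 1) \<in> degree n ` partitions n"
      using stair by (metis imageI)
  qed
  then show ?thesis
    using stair less by force
qed

end
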